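(* Let $d\ge 1$ and let $\rho^*\in\mathcal P$ be any smooth, positive probability density on $\mathbb R^d$. Then the functional $\rho\mapsto \mathrm{KL}[\rho\Vert\rho^*]=\int\rho\log\frac{\rho}{\rho^*}\,d\theta$ is not geodesically convex on $\mathcal P$ within the Fisher-Rao geometry. Furthermore, for any $\epsilon>0$, it is not geodesically convex in the neighborhood $\{\rho\in\mathcal P:\mathrm{KL}[\rho\Vert\rho^*]\le\epsilon\}$ of $\rho^*$; that is, there exist $\rho\in\mathcal P$ with $\mathrm{KL}[\rho\Vert\rho^*]\le\epsilon$ and a tangent vector $\sigma$ at $\rho$ such that $g^{\mathrm{FR}}_\rho(\mathrm{Hess}_{\mathrm{FR}}\mathrm{KL}[\rho\Vert\rho^*]\,\sigma,\sigma)<0$.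
   Context: $\mathcal P=\{\rho\in C^\infty(\mathbb R^d):\int\rho\,d\theta=1,\ \rho>0\}$. Tangent vectors at $\rho\in\mathcal P$ are written $\sigma=\rho(\psi-\mathbb E_\rho[\psi])$ with $\psi$ a smooth function on $\mathbb R^d$, where $\mathbb E_\rho[\psi]=\int\rho\psi\,d\theta$. The Fisher-Rao metric is $g^{\mathrm{FR}}_\rho(\sigma_1,\sigma_2)=\int\frac{\sigma_1\sigma_2}{\rho}\,d\theta$. Its constant-speed geodesics satisfy $\partial_t\rho_t=\rho_t(\psi_t-\mathbb E_{\rho_t}[\psi_t])$, $\partial_t\psi_t=-\frac12(\psi_t-\mathbb E_{\rho_t}[\psi_t])^2$. The Fisher-Rao Hessian of an energy is its second derivative along the geodesic starting at $\rho$ with velocity $\sigma$; for the KL divergence it is given by $$g^{\mathrm{FR}}_\rho(\mathrm{Hess}_{\mathrm{FR}}\mathrm{KL}[\rho\Vert\rho^*]\sigma,\sigma)=\int\rho(\psi-\mathbb E_\rho[\psi])^2\,d\theta+\frac12\int\rho(\psi-\mathbb E_\rho[\psi])^2\Bigl(\log\frac{\rho}{\rho^*}-\mathbb E_\rho\bigl[\log\frac{\rho}{\rho^*}\bigr]\Bigr)d\theta .$$ Geodesic convexity on a set $S\subset\mathcal P$ means that this quantity is $\ge 0$ for every $\rho\in S$ and every tangent vector $\sigma$ at $\rho$ for which all the integrals involved converge absolutely. *)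

theory Defs
  imports "HOL-Analysis.Analysis"
begin

text \<open>\<open>Ck_fun k f\<close>: all partial derivatives of \<open>f\<close> up to order \<open>k\<close> exist and are continuous;
  differentiability of \<open>f\<close> itself is automatic for \<open>C\<^sup>1\<close> functions and is required here
  so that \<open>frechet_derivative\<close> is meaningful.\<close>

primrec Ck_fun :: "nat \<Rightarrow> ('a::euclidean_space \<Rightarrow> real) \<Rightarrow> bool" where
  "Ck_fun 0 f \<longleftrightarrow> continuous_on UNIV f"
| "Ck_fun (Suc k) f \<longleftrightarrow> (\<forall>x. f differentiable (at x)) \<and>
     (\<forall>b\<in>Basis. Ck_fun k (\<lambda>x. frechet_derivative f (at x) b))"

definition smooth_fun :: "('a::euclidean_space \<Rightarrow> real) \<Rightarrow> bool" where
  "smooth_fun f \<longleftrightarrow> (\<forall>k. Ck_fun k f)"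

definition smooth_densities :: "('a::euclidean_space \<Rightarrow> real) set" where
  "smooth_densities =
     {\<rho>. smooth_fun \<rho> \<and> (\<forall>x. 0 < \<rho> x) \<and> integrable lborel \<rho> \<and> (\<integral>x. \<rho> x \<partial>lborel) = 1}"

definition expect :: "('a::euclidean_space \<Rightarrow> real) \<Rightarrow> ('a \<Rightarrow> real) \<Rightarrow> real" where
  "expect \<rho> f = (\<integral>x. \<rho> x * f x \<partial>lborel)"

text \<open>For densities \<open>\<rho>\<close> and \<open>\<rho>s\<close> the negative part of \<open>\<rho> ln (\<rho> / \<rho>s)\<close> is always integrable, because
  \<open>\<rho> ln (\<rho> / \<rho>s) \<ge> \<rho> - \<rho>s\<close>. Hence the divergence is \<open>\<infinity>\<close> exactly when the integrand is not integrable
  (where the Bochner integral would return the junk value 0).\<close>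

definition KL :: "('a::euclidean_space \<Rightarrow> real) \<Rightarrow> ('a \<Rightarrow> real) \<Rightarrow> ereal" where
  "KL \<rho> \<rho>s =
     (if integrable lborel (\<lambda>x. \<rho> x * ln (\<rho> x / \<rho>s x))
      then ereal (\<integral>x. \<rho> x * ln (\<rho> x / \<rho>s x) \<partial>lborel) else \<infinity>)"

text \<open>\<open>FR_tangent \<rho> \<psi> \<sigma>\<close>: \<open>\<sigma>\<close> is the tangent vector at \<open>\<rho>\<close> with potential \<open>\<psi>\<close>. The potential is
  determined by \<open>\<sigma>\<close> up to an additive constant.\<close>

definition FR_tangent ::
  "('a::euclidean_space \<Rightarrow> real) \<Rightarrow> ('a \<Rightarrow> real) \<Rightarrow> ('a \<Rightarrow> real) \<Rightarrow> bool" where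
  "FR_tangent \<rho> \<psi> \<sigma> \<longleftrightarrow> smooth_fun \<psi> \<and> integrable lborel (\<lambda>x. \<rho> x * \<psi> x) \<and>
     \<sigma> = (\<lambda>x. \<rho> x * (\<psi> x - expect \<rho> \<psi>))"

text \<open>The quadratic form \<open>g\<^sub>\<rho>(Hess KL[\<rho> || \<rho>s] \<sigma>, \<sigma>)\<close> of the Fisher-Rao Hessian of \<open>KL(\<cdot>, \<rho>s)\<close>, for the
  tangent vector \<open>\<sigma> = \<rho> (\<psi> - E\<^sub>\<rho> \<psi>)\<close>. It is obtained by differentiating \<open>KL(\<rho>\<^sub>t, \<rho>s)\<close> twice at \<open>t = 0\<close>
  along the geodesic equations
  \<open>\<partial>\<^sub>t \<rho> = \<rho> (\<psi> - E\<^sub>\<rho> \<psi>)\<close>, \<open>\<partial>\<^sub>t \<psi> = - (\<psi> - E\<^sub>\<rho> \<psi>)\<^sup>2 / 2\<close>.\<close>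

definition FR_Hess_KL ::
  "('a::euclidean_space \<Rightarrow> real) \<Rightarrow> ('a \<Rightarrow> real) \<Rightarrow> ('a \<Rightarrow> real) \<Rightarrow> real" where
  "FR_Hess_KL \<rho>s \<rho> \<psi> =
     (\<integral>x. \<rho> x * (\<psi> x - expect \<rho> \<psi>)\<^sup>2 \<partial>lborel) +
     1/2 * (\<integral>x. \<rho> x * (\<psi> x - expect \<rho> \<psi>)\<^sup>2 *
        (ln (\<rho> x / \<rho>s x) - expect \<rho> (\<lambda>y. ln (\<rho> y / \<rho>s y))) \<partial>lborel)"

text \<open>Absolute convergence of all integrals in \<open>FR_Hess_KL\<close>, other than \<open>E\<^sub>\<rho> \<psi>\<close>, whose convergence is
  part of \<open>FR_tangent\<close>.\<close>

definition FR_Hess_KL_converges ::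
  "('a::euclidean_space \<Rightarrow> real) \<Rightarrow> ('a \<Rightarrow> real) \<Rightarrow> ('a \<Rightarrow> real) \<Rightarrow> bool" where
  "FR_Hess_KL_converges \<rho>s \<rho> \<psi> \<longleftrightarrow>
     integrable lborel (\<lambda>x. \<rho> x * ln (\<rho> x / \<rho>s x)) \<and>
     integrable lborel (\<lambda>x. \<rho> x * (\<psi> x - expect \<rho> \<psi>)\<^sup>2) \<and>
     integrable lborel (\<lambda>x. \<rho> x * (\<psi> x - expect \<rho> \<psi>)\<^sup>2 *
        (ln (\<rho> x / \<rho>s x) - expect \<rho> (\<lambda>y. ln (\<rho> y / \<rho>s y))))"

lemma FR_tangent_potential_unique:
  assumes "\<rho> \<in> smooth_densities" "FR_tangent \<rho> \<psi>1 \<sigma>" "FR_tangent \<rho> \<psi>2 \<sigma>"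
  shows "FR_Hess_KL \<rho>s \<rho> \<psi>1 = FR_Hess_KL \<rho>s \<rho> \<psi>2"
    and "FR_Hess_KL_converges \<rho>s \<rho> \<psi>1 \<longleftrightarrow> FR_Hess_KL_converges \<rho>s \<rho> \<psi>2"
proof -
  have "\<psi>1 x - expect \<rho> \<psi>1 = \<psi>2 x - expect \<rho> \<psi>2" for x
  proof -
    have "\<rho> x * (\<psi>1 x - expect \<rho> \<psi>1) = \<rho> x * (\<psi>2 x - expect \<rho> \<psi>2)"
      using assms(2,3) unfolding FR_tangent_def by metis
    moreover have "\<rho> x > 0" using assms(1) by (simp add: smooth_densities_def)
    ultimately show ?thesis by simp
  qed
  then show "FR_Hess_KL \<rho>s \<rho> \<psi>1 = FR_Hess_KL \<rho>s \<rho> \<psi>2"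
    and "FR_Hess_KL_converges \<rho>s \<rho> \<psi>1 \<longleftrightarrow> FR_Hess_KL_converges \<rho>s \<rho> \<psi>2"
    by (simp_all add: FR_Hess_KL_def FR_Hess_KL_converges_def)
qed

definition FR_KL_geodesically_convex_on ::
  "('a::euclidean_space \<Rightarrow> real) set \<Rightarrow> ('a \<Rightarrow> real) \<Rightarrow> bool" where
  "FR_KL_geodesically_convex_on S \<rho>s \<longleftrightarrow>
     (\<forall>\<rho>\<in>S. \<forall>\<sigma> \<psi>. FR_tangent \<rho> \<psi> \<sigma> \<longrightarrow> FR_Hess_KL_converges \<rho>s \<rho> \<psi> \<longrightarrow> 0 \<le> FR_Hess_KL \<rho>s \<rho> \<psi>)"

definition KL_neighborhood ::
  "('a::euclidean_space \<Rightarrow> real) \<Rightarrow> real \<Rightarrow> ('a \<Rightarrow> real) set" where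
  "KL_neighborhood \<rho>s \<epsilon> = {\<rho> \<in> smooth_densities. KL \<rho> \<rho>s \<le> ereal \<epsilon>}"

end

theory Submission
  imports Defs
begin

text \<open>Tilt \<open>\<rho>s\<close> to \<open>\<rho> = \<rho>s exp (-h) / Z\<close> with a smooth bump \<open>0 \<le> h \<le> 4\<close> that has height \<open>4\<close> at
  the origin and is so narrow that \<open>q = \<integral> \<rho>s h\<close> is tiny. Then \<open>Z \<ge> 1 - q\<close>, so \<open>KL(\<rho>, \<rho>s) \<le> - ln Z\<close>
  is tiny too, and \<open>E\<^sub>\<rho> h \<le> 1\<close>. Since \<open>ln (\<rho> / \<rho>s)\<close> minus its mean is \<open>E\<^sub>\<rho> h - h\<close>, the Hessian form at
  a centred potential \<open>\<psi>\<close> is \<open>\<integral> \<rho> \<psi>\<^sup>2 (1 + (E\<^sub>\<rho> h - h) / 2)\<close>, which is negative as soon as \<open>\<psi>\<close>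
  vanishes outside \<open>{h > 3}\<close>.\<close>

section \<open>Calculus of smooth functions\<close>

lemma Ck_fun_const: "Ck_fun k (\<lambda>x. c)"
  by (induction k arbitrary: c) simp_all

lemma Ck_fun_imp_continuous: "Ck_fun k f \<Longrightarrow> continuous_on UNIV f"
  by (cases k)
    (auto simp: continuous_on_eq_continuous_at intro: differentiable_imp_continuous_within)

lemma Ck_fun_Suc_D: "Ck_fun (Suc k) f \<Longrightarrow> Ck_fun k f"
proof (induction k arbitrary: f)
  case 0
  then show ?case by (metis Ck_fun.simps(1) Ck_fun_imp_continuous)
next
  case (Suc k)
  then show ?case by (metis Ck_fun.simps(2))
qed

text \<open>Uniqueness of the Frechet derivative lets an explicit formula stand in for
  \<open>frechet_derivative\<close>; the regularity proofs below go through this rule.\<close>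

lemma Ck_fun_SucI:
  assumes "\<And>x. (f has_derivative f' x) (at x)" "\<And>b. b \<in> Basis \<Longrightarrow> Ck_fun k (\<lambda>x. f' x b)"
  shows "Ck_fun (Suc k) f"
proof -
  have "frechet_derivative f (at x) = f' x" for x
    using assms(1) frechet_derivative_at by metis
  then show ?thesis
    using assms by (auto simp: differentiable_def)
qed

lemma Ck_fun_add: "Ck_fun k f \<Longrightarrow> Ck_fun k g \<Longrightarrow> Ck_fun k (\<lambda>x. f x + g x)"
proof (induction k arbitrary: f g)
  case 0
  then show ?case by (simp add: continuous_on_add)
next
  case (Suc k)
  show ?case
  proof (rule Ck_fun_SucI)
    show "((\<lambda>x. f x + g x) has_derivative
        (\<lambda>v. frechet_derivative f (at x) v + frechet_derivative g (at x) v)) (at x)" for x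
      using Suc.prems by (auto intro!: has_derivative_add simp: frechet_derivative_works[symmetric])
  qed (use Suc in auto)
qed

lemma Ck_fun_mult: "Ck_fun k f \<Longrightarrow> Ck_fun k g \<Longrightarrow> Ck_fun k (\<lambda>x. f x * g x)"
proof (induction k arbitrary: f g)
  case 0
  then show ?case by (simp add: continuous_on_mult)
next
  case (Suc k)
  show ?case
  proof (rule Ck_fun_SucI)
    show "((\<lambda>x. f x * g x) has_derivative
        (\<lambda>v. f x * frechet_derivative g (at x) v + frechet_derivative f (at x) v * g x)) (at x)" for x
      using Suc.prems by (auto intro!: has_derivative_mult simp: frechet_derivative_works[symmetric])
  next
    fix b :: 'a assume "b \<in> Basis"
    then show "Ck_fun k (\<lambda>x. f x * frechet_derivative g (at x) b + frechet_derivative f (at x) b * g x)"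
      \<comment> \<open>The product rule pairs each derivative, of class \<open>k\<close>, with an
        undifferentiated factor of class \<open>Suc k\<close>, which must first be lowered to
        \<open>k\<close>.\<close>
      using Suc.prems Ck_fun_Suc_D[OF Suc.prems(1)] Ck_fun_Suc_D[OF Suc.prems(2)]
      by (intro Ck_fun_add Suc.IH) auto
  qed
qed

lemma Ck_fun_compose:
  fixes u :: "real \<Rightarrow> real"
  shows "Ck_fun k u \<Longrightarrow> Ck_fun k f \<Longrightarrow> Ck_fun k (\<lambda>x. u (f x))"
proof (induction k arbitrary: u f)
  case 0
  then show ?case
    using continuous_on_compose2[of UNIV u UNIV f] by simp
next
  case (Suc k)
  show ?case
  proof (rule Ck_fun_SucI)
    fix x
    have u: "(u has_derivative frechet_derivative u (at (f x))) (at (f x))"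
      using Suc.prems by (simp add: frechet_derivative_works[symmetric])
    \<comment> \<open>A linear map on the reals is multiplication by its value at 1. This turns the
      chain rule into a product, so that \<open>Ck_fun_mult\<close> and the induction hypothesis for
      the derivative of \<open>u\<close> apply.\<close>
    have "frechet_derivative u (at (f x)) = (\<lambda>v. frechet_derivative u (at (f x)) 1 * v)"
    proof
      fix v
      show "frechet_derivative u (at (f x)) v = frechet_derivative u (at (f x)) 1 * v"
        using linear_simps(5)[OF has_derivative_bounded_linear[OF u], of v 1]
        by (simp add: mult.commute)
    qed
    with u have "(u has_derivative (\<lambda>v. frechet_derivative u (at (f x)) 1 * v)) (at (f x))"
      by (rule back_subst[where P = "\<lambda>D. (u has_derivative D) (at (f x))"])
    moreover have "(f has_derivative frechet_derivative f (at x)) (at x)"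
      using Suc.prems by (simp add: frechet_derivative_works[symmetric])
    ultimately show "((\<lambda>x. u (f x)) has_derivative
        (\<lambda>v. frechet_derivative u (at (f x)) 1 * frechet_derivative f (at x) v)) (at x)"
      using has_derivative_compose by fast
  next
    fix b :: 'a assume "b \<in> Basis"
    then show "Ck_fun k (\<lambda>x. frechet_derivative u (at (f x)) 1 * frechet_derivative f (at x) b)"
      using Suc.prems Ck_fun_Suc_D[OF Suc.prems(2)]
        Suc.IH[of "\<lambda>y. frechet_derivative u (at y) 1" f] by (auto intro!: Ck_fun_mult)
  qed
qed

lemma Ck_fun_inner_left: "Ck_fun k (\<lambda>x. x \<bullet> v)"
proof (cases k)
  case (Suc n)
  have "((\<lambda>x. x \<bullet> v) has_derivative (\<lambda>w. w \<bullet> v)) (at x)" for x :: 'a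
    by (auto intro!: derivative_eq_intros)
  then show ?thesis
    unfolding Suc by (rule Ck_fun_SucI) (rule Ck_fun_const)
qed (simp add: continuous_on_inner continuous_on_exp continuous_on_id)

lemma Ck_fun_inner_self: "Ck_fun k (\<lambda>x. x \<bullet> x)"
proof (cases k)
  case (Suc n)
  have "((\<lambda>x. x \<bullet> x) has_derivative (\<lambda>w. 2 * (x \<bullet> w))) (at x)" for x :: 'a
    by (auto intro!: derivative_eq_intros simp: inner_commute)
  moreover have "Ck_fun n (\<lambda>x. 2 * (x \<bullet> b))" for b :: 'a
    by (intro Ck_fun_mult Ck_fun_const Ck_fun_inner_left)
  ultimately show ?thesis
    unfolding Suc by (rule Ck_fun_SucI)
qed (simp add: continuous_on_inner continuous_on_exp continuous_on_id)

lemma Ck_fun_exp: "Ck_fun k (exp :: real \<Rightarrow> real)"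
proof (induction k)
  case (Suc k)
  have "(exp has_derivative (\<lambda>w. exp x * w)) (at x)" for x :: real
    using DERIV_exp[of x] by (simp add: has_field_derivative_def)
  then show ?case
    by (rule Ck_fun_SucI) (use Suc in simp)
qed (simp add: continuous_on_inner continuous_on_exp continuous_on_id)

lemma smooth_fun_const: "smooth_fun (\<lambda>x. c)"
  by (simp add: smooth_fun_def Ck_fun_const)

lemma smooth_fun_add: "smooth_fun f \<Longrightarrow> smooth_fun g \<Longrightarrow> smooth_fun (\<lambda>x. f x + g x)"
  using Ck_fun_add[of _ f g] by (simp add: smooth_fun_def)

lemma smooth_fun_mult: "smooth_fun f \<Longrightarrow> smooth_fun g \<Longrightarrow> smooth_fun (\<lambda>x. f x * g x)"
  using Ck_fun_mult[of _ f g] by (simp add: smooth_fun_def)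

lemma smooth_fun_minus: "smooth_fun f \<Longrightarrow> smooth_fun (\<lambda>x. - f x)"
  using smooth_fun_mult[OF smooth_fun_const[of "-1"], of f] by simp

lemma smooth_fun_diff: "smooth_fun f \<Longrightarrow> smooth_fun g \<Longrightarrow> smooth_fun (\<lambda>x. f x - g x)"
  using smooth_fun_add[OF _ smooth_fun_minus, of f g] by simp

lemma smooth_fun_compose:
  fixes u :: "real \<Rightarrow> real"
  shows "smooth_fun u \<Longrightarrow> smooth_fun f \<Longrightarrow> smooth_fun (\<lambda>x. u (f x))"
  using Ck_fun_compose[of _ u f] by (simp add: smooth_fun_def)

lemma smooth_fun_inner_self: "smooth_fun (\<lambda>x. x \<bullet> x)"
  by (simp add: smooth_fun_def Ck_fun_inner_self)

lemma smooth_fun_exp: "smooth_fun (exp :: real \<Rightarrow> real)"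
  by (simp add: smooth_fun_def Ck_fun_exp)

lemma smooth_fun_imp_continuous: "smooth_fun f \<Longrightarrow> continuous_on UNIV f"
  using Ck_fun_imp_continuous by (auto simp: smooth_fun_def)

lemmas smooth_intros = smooth_fun_const smooth_fun_add smooth_fun_mult smooth_fun_minus
  smooth_fun_diff smooth_fun_inner_self smooth_fun_compose[OF smooth_fun_exp]

section \<open>A smooth function vanishing on the negative half line\<close>

text \<open>The powers of \<open>t\<close> make the family closed under differentiation up to linear combinations.\<close>

definition flat :: "nat \<Rightarrow> real \<Rightarrow> real" where
  "flat m t = (if t > 0 then exp (- 1 / t) / t ^ m else 0)"

lemma flat_nonneg: "0 \<le> flat m t"
  by (simp add: flat_def)

text \<open>From the right, \<open>s = 1 / t\<close> reduces the claim to
  \<open>s ^ m / exp s\<close> tending to 0 at infinity.\<close>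

lemma flat_tendsto_0: "(flat m \<longlongrightarrow> 0) (at 0)"
proof -
  have "((\<lambda>s::real. s ^ m / exp s) \<longlongrightarrow> 0) at_top"
    by (rule tendsto_power_div_exp_0)
  then have "((\<lambda>t::real. inverse t ^ m / exp (inverse t)) \<longlongrightarrow> 0) (at_right 0)"
    by (rule filterlim_compose[OF _ filterlim_inverse_at_top_right])
  moreover have "\<forall>\<^sub>F t in at_right 0. inverse t ^ m / exp (inverse t) = flat m t"
    using eventually_at_right_less[of 0]
    by eventually_elim (simp add: flat_def exp_minus field_simps)
  ultimately have "(flat m \<longlongrightarrow> 0) (at_right 0)"
    using tendsto_cong by fast
  moreover have "\<forall>\<^sub>F t in at_left 0. 0 = flat m t"
    by (auto simp: flat_def eventually_at_left_field intro!: exI[of _ "-1"])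
  then have "(flat m \<longlongrightarrow> 0) (at_left 0)"
    using tendsto_cong tendsto_const by fast
  ultimately show ?thesis
    by (simp add: filterlim_split_at)
qed

lemma flat_has_derivative:
  "(flat m has_real_derivative flat (m + 2) t - real m * flat (m + 1) t) (at t)"
proof (cases t "0::real" rule: linorder_cases)
  case less
  have "((\<lambda>t. 0) has_real_derivative 0) (at t)"
    by simp
  then have "(flat m has_real_derivative 0) (at t)"
    by (rule has_field_derivative_transform_within_open[where S = "{..<0}"])
      (use less in \<open>auto simp: flat_def\<close>)
  then show ?thesis
    using less by (simp add: flat_def)
next
  case equal
  \<comment> \<open>The difference quotient at 0 is itself a member of the family, so its limit is
    known. At \<open>h = 0\<close> both sides are 0 because division by zero yields 0.\<close>
  have "flat m h / h = flat (Suc m) h" for h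
    by (simp add: flat_def)
  then show ?thesis
    using flat_tendsto_0[of "m + 1"] equal by (simp add: DERIV_def flat_def[of _ 0])
next
  case greater
  have "((\<lambda>t. exp (- 1 / t) / t ^ m) has_real_derivative flat (m + 2) t - real m * flat (m + 1) t) (at t)"
    using greater
    by (cases m)
      (auto intro!: derivative_eq_intros simp: flat_def field_simps power2_eq_square,
        metis One_nat_def power_eq_if)
  then show ?thesis
    by (rule has_field_derivative_transform_within_open[where S = "{0<..}"])
      (use greater in \<open>auto simp: flat_def\<close>)
qed

lemma Ck_fun_flat: "Ck_fun k (flat m)"
proof (induction k arbitrary: m)
  case 0
  then show ?case
    by (simp add: continuous_on_eq_continuous_at)
      (metis DERIV_isCont flat_has_derivative)
next
  case (Suc k)
  have "(flat m has_derivative (\<lambda>w. (flat (m + 2) t + (- real m) * flat (m + 1) t) * w)) (at t)" for t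
    using flat_has_derivative[of m t] by (simp add: has_field_derivative_def)
  then show ?case
    by (rule Ck_fun_SucI) (intro Ck_fun_mult Ck_fun_add Ck_fun_const Suc)
qed

lemma smooth_fun_flat: "smooth_fun (flat m)"
  by (simp add: smooth_fun_def Ck_fun_flat)

lemma flat_0_pos_iff: "0 < flat 0 t \<longleftrightarrow> 0 < t"
  by (simp add: flat_def)

lemma flat_0_le_1: "flat 0 t \<le> 1"
  by (simp add: flat_def)

lemma flat_0_mono: "s \<le> t \<Longrightarrow> flat 0 s \<le> flat 0 t"
  by (auto simp: flat_def field_simps)

section \<open>Narrow bumps\<close>

text \<open>As \<open>flat 0 1 = exp (-1)\<close>, the prefactor makes the peak exactly 4. For
  \<open>n \<ge> 1\<close> the support is the closed ball of radius \<open>1 / sqrt n\<close>; the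
  squared norm keeps the argument smooth at the origin.\<close>

definition bump :: "nat \<Rightarrow> 'a::euclidean_space \<Rightarrow> real" where
  "bump n x = 4 * exp 1 * flat 0 (1 - real n * (x \<bullet> x))"

lemma smooth_fun_bump: "smooth_fun (bump n)"
  unfolding bump_def
  by (intro smooth_intros smooth_fun_compose[OF smooth_fun_flat])

lemma bump_nonneg: "0 \<le> bump n x"
  by (simp add: bump_def flat_nonneg)

lemma bump_zero: "bump n 0 = 4"
  by (simp add: bump_def flat_def exp_minus)

lemma bump_le: "bump n x \<le> 4"
proof -
  have "flat 0 (1 - real n * (x \<bullet> x)) \<le> flat 0 1"
    by (rule flat_0_mono) simp
  then have "bump n x \<le> 4 * exp 1 * flat 0 1"
    by (simp add: bump_def)
  also have "\<dots> = 4"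
    by (simp add: flat_def exp_minus)
  finally show ?thesis .
qed

lemma bump_tendsto_0:
  assumes "x \<noteq> 0"
  shows "(\<lambda>n. bump n x) \<longlonglongrightarrow> 0"
proof (rule tendsto_eventually)
  obtain N :: nat where N: "1 / (x \<bullet> x) < real N"
    using reals_Archimedean2 by blast
  have "bump n x = 0" if "n \<ge> N" for n
  proof -
    have "1 / (x \<bullet> x) < real n" using N that by linarith
    then have "1 < real n * (x \<bullet> x)" using assms by (simp add: field_simps)
    then show ?thesis by (simp add: bump_def flat_def)
  qed
  then show "\<forall>\<^sub>F n in sequentially. bump n x = 0"
    using eventually_sequentially by blast
qed

section \<open>Integration against a density\<close>

lemma integrable_mult_bounded:
  fixes \<rho> g :: "'a::euclidean_space \<Rightarrow> real"
  assumes "integrable lborel \<rho>" "continuous_on UNIV g" "\<And>x. \<bar>g x\<bar> \<le> B"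
  shows "integrable lborel (\<lambda>x. \<rho> x * g x)"
proof (rule Bochner_Integration.integrable_bound)
  show "integrable lborel (\<lambda>x. B * \<rho> x)" using assms(1) by simp
  have "g \<in> borel_measurable borel" using assms(2) by (rule borel_measurable_continuous_onI)
  then show "(\<lambda>x. \<rho> x * g x) \<in> borel_measurable lborel" using assms(1) by simp
  have "\<bar>\<rho> x\<bar> * \<bar>g x\<bar> \<le> \<bar>B\<bar> * \<bar>\<rho> x\<bar>" for x
    using assms(3)[of x] mult_right_mono[of "\<bar>g x\<bar>" "\<bar>B\<bar>" "\<bar>\<rho> x\<bar>"] by (simp add: mult.commute)
  then show "AE x in lborel. norm (\<rho> x * g x) \<le> norm (B * \<rho> x)"
    by (simp add: abs_mult)
qed

text \<open>If the integral were 0, the closed zero set of \<open>f\<close> would have full Lebesgue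
  measure and hence contain every point, including \<open>a\<close>.\<close>

lemma integral_pos_of_continuous:
  fixes f :: "'a::euclidean_space \<Rightarrow> real"
  assumes "continuous_on UNIV f" "integrable lborel f" "\<And>x. 0 \<le> f x" "0 < f a"
  shows "0 < (\<integral>x. f x \<partial>lborel)"
proof (rule ccontr)
  assume "\<not> ?thesis"
  moreover have "0 \<le> (\<integral>x. f x \<partial>lborel)" using assms(3) by simp
  ultimately have "(\<integral>x. f x \<partial>lborel) = 0" by linarith
  then have "AE x in lborel. x \<in> {x. f x = 0}"
    using integral_nonneg_eq_0_iff_AE[OF assms(2)] assms(3) by simp
  moreover have "closed {x. f x = 0}"
    using closed_Collect_eq[OF assms(1) continuous_on_const] .
  ultimately have "a \<in> {x. f x = 0}"
    using mem_closed_if_AE_lebesgue AE_completion by blast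
  then show False using assms(4) by simp
qed

text \<open>Dominated convergence with majorant \<open>4 * norm (\<rho> x)\<close>; pointwise
  convergence fails at most at the origin, a null set.\<close>

lemma integral_bump_tendsto_0:
  fixes \<rho> :: "'a::euclidean_space \<Rightarrow> real"
  assumes "integrable lborel \<rho>"
  shows "(\<lambda>n. \<integral>x. \<rho> x * bump n x \<partial>lborel) \<longlonglongrightarrow> 0"
proof -
  have "(\<lambda>n. \<integral>x. \<rho> x * bump n x \<partial>lborel) \<longlonglongrightarrow> (\<integral>(x::'a). 0 \<partial>lborel)"
  proof (rule integral_dominated_convergence[where w = "\<lambda>x. 4 * norm (\<rho> x)"])
    show "(\<lambda>x. \<rho> x * bump n x) \<in> borel_measurable lborel" for n
      using borel_measurable_integrable[OF assms]
        borel_measurable_continuous_onI[OF smooth_fun_imp_continuous[OF smooth_fun_bump]]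
      by (auto intro: borel_measurable_times)
    show "integrable lborel (\<lambda>x. 4 * norm (\<rho> x))" using assms by simp
    show "AE x in lborel. norm (\<rho> x * bump n x) \<le> 4 * norm (\<rho> x)" for n
      by (intro AE_I2) (simp add: abs_mult bump_nonneg bump_le mult_left_mono mult.commute[of 4])
    have "AE x in lborel. x \<noteq> (0::'a)" by (rule AE_lborel_singleton)
    then show "AE x in lborel. (\<lambda>n. \<rho> x * bump n x) \<longlonglongrightarrow> 0"
      by eventually_elim (auto intro!: tendsto_mult_right_zero bump_tendsto_0)
  qed simp
  then show ?thesis by simp
qed

section \<open>Negative Hessian near the reference density\<close>

lemma exists_negative_FR_Hess_KL:
  fixes \<rho>s :: "'a::euclidean_space \<Rightarrow> real"
  assumes "\<rho>s \<in> smooth_densities" "0 < \<epsilon>"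
  shows "\<exists>\<rho>\<in>KL_neighborhood \<rho>s \<epsilon>. \<exists>\<sigma> \<psi>. FR_tangent \<rho> \<psi> \<sigma> \<and> FR_Hess_KL_converges \<rho>s \<rho> \<psi> \<and>
          FR_Hess_KL \<rho>s \<rho> \<psi> < 0"
proof -

  \<comment> \<open>Choice of a narrow bump\<close>
  have s_smooth: "smooth_fun \<rho>s" and s_pos: "0 < \<rho>s x" and s_int: "integrable lborel \<rho>s"
    and s_one: "(\<integral>x. \<rho>s x \<partial>lborel) = 1" for x
    using assms(1) by (auto simp: smooth_densities_def)
  \<comment> \<open>The bound \<open>\<epsilon>/2\<close> serves the estimate that the divergence is
    at most \<open>2 * q\<close>; the bound \<open>1/4\<close> gives \<open>q / Z \<le> 1\<close>
    and \<open>2 * q \<le> 1\<close>.\<close>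
  have "\<forall>\<^sub>F n in sequentially. (\<integral>x. \<rho>s x * bump n x \<partial>lborel) < min (1/4) (\<epsilon>/2)"
    using assms(2) by (intro order_tendstoD(2)[OF integral_bump_tendsto_0[OF s_int]]) simp
  \<comment> \<open>With \<open>n \<ge> 1\<close> the bump vanishes at unit vectors, so it is not
    constant.\<close>
  then have "\<forall>\<^sub>F n in sequentially. n \<ge> 1 \<and> (\<integral>x. \<rho>s x * bump n x \<partial>lborel) < min (1/4) (\<epsilon>/2)"
    by (intro eventually_conj eventually_ge_at_top)
  then obtain n where n: "n \<ge> 1" and "(\<integral>x. \<rho>s x * bump n x \<partial>lborel) < min (1/4) (\<epsilon>/2)"
    using eventually_happens' sequentially_bot by blast
  define h where "h = (bump n :: 'a \<Rightarrow> real)"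
  define q where "q = (\<integral>x. \<rho>s x * h x \<partial>lborel)"
  have q: "q < 1/4" "q < \<epsilon>/2"
    using \<open>_ < min (1/4) (\<epsilon>/2)\<close> by (simp_all add: q_def h_def)
  have h_smooth: "smooth_fun h" and h_nonneg: "0 \<le> h x" and h_le: "h x \<le> 4" and h_0: "h 0 = 4" for x
    by (simp_all add: h_def smooth_fun_bump bump_nonneg bump_le bump_zero)
  note h_cont = smooth_fun_imp_continuous[OF h_smooth]
  have h_int: "integrable lborel (\<lambda>x. \<rho>s x * h x)"
    by (rule integrable_mult_bounded[OF s_int h_cont, of 4]) (simp add: h_nonneg h_le)
  have q_nonneg: "0 \<le> q"
    unfolding q_def by (intro Bochner_Integration.integral_nonneg) (simp add: h_nonneg s_pos less_imp_le)

  \<comment> \<open>The tilted density and its divergence from the reference density\<close>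
  define Z where "Z = (\<integral>x. \<rho>s x * exp (- h x) \<partial>lborel)"
  have w_int: "integrable lborel (\<lambda>x. \<rho>s x * exp (- h x))"
    by (rule integrable_mult_bounded[OF s_int, of _ 1])
      (auto intro!: continuous_intros h_cont simp: h_nonneg)
  have "1 - q = (\<integral>x. \<rho>s x - \<rho>s x * h x \<partial>lborel)"
    using s_int h_int by (simp add: q_def s_one)
  also have "\<dots> \<le> Z"
    unfolding Z_def
  proof (rule integral_mono)
    show "\<rho>s x - \<rho>s x * h x \<le> \<rho>s x * exp (- h x)" for x
      using mult_left_mono[OF exp_ge_add_one_self[of "- h x"], of "\<rho>s x"] s_pos[of x]
      by (simp add: algebra_simps)
  qed (use s_int h_int w_int in auto)
  finally have Z_ge: "1 - q \<le> Z" .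
  then have Z_pos: "0 < Z" using q by linarith
  \<comment> \<open>Keeping the normalisation \<open>ln Z\<close> in the exponent makes both
    smoothness and the log ratio immediate.\<close>
  define \<rho> where "\<rho> = (\<lambda>x. \<rho>s x * exp (- h x - ln Z))"
  have \<rho>_eq: "\<rho> x = (\<rho>s x * exp (- h x)) / Z" for x
    using Z_pos by (simp add: \<rho>_def exp_diff)
  have \<rho>_pos: "0 < \<rho> x" for x
    by (simp add: \<rho>_def s_pos)
  have \<rho>_int: "integrable lborel \<rho>"
    using w_int by (simp add: ext[of \<rho>, OF \<rho>_eq])
  have \<rho>_smooth: "smooth_fun \<rho>"
    unfolding \<rho>_def by (intro smooth_intros s_smooth h_smooth)
  note \<rho>_cont = smooth_fun_imp_continuous[OF \<rho>_smooth]
  have \<rho>_one: "(\<integral>x. \<rho> x \<partial>lborel) = 1"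
    using Z_pos by (simp add: \<rho>_eq Z_def)
  have \<rho>_dens: "\<rho> \<in> smooth_densities"
    by (simp add: smooth_densities_def \<rho>_pos \<rho>_int \<rho>_smooth \<rho>_one)
  have ln_eq: "ln (\<rho> x / \<rho>s x) = - h x - ln Z" for x
    using s_pos[of x] by (simp add: \<rho>_def)
  define m where "m = (\<integral>x. \<rho> x * h x \<partial>lborel)"
  have \<rho>h_int: "integrable lborel (\<lambda>x. \<rho> x * h x)"
    by (rule integrable_mult_bounded[OF \<rho>_int h_cont, of 4]) (simp add: h_nonneg h_le)
  have m_nonneg: "0 \<le> m"
    unfolding m_def by (intro Bochner_Integration.integral_nonneg) (simp add: h_nonneg \<rho>_pos less_imp_le)
  have "m \<le> (\<integral>x. (\<rho>s x * h x) / Z \<partial>lborel)"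
    unfolding m_def
  proof (rule integral_mono)
    show "\<rho> x * h x \<le> \<rho>s x * h x / Z" for x
    proof -
      have "(\<rho>s x * h x) * exp (- h x) \<le> \<rho>s x * h x"
        using s_pos[of x] h_nonneg[of x] by (intro mult_right_le_one_le) auto
      then show ?thesis
        using Z_pos by (simp add: \<rho>_eq divide_right_mono mult_ac)
    qed
  qed (use h_int \<rho>h_int in auto)
  also have "\<dots> = q / Z" by (simp add: q_def)
  also have "\<dots> \<le> 1" using Z_ge Z_pos q by simp
  finally have m_le: "m \<le> 1" .
  have ln_int: "integrable lborel (\<lambda>x. \<rho> x * (- h x - ln Z))"
    using \<rho>h_int \<rho>_int by (simp add: right_diff_distrib)
  have ln_mean: "(\<integral>x. \<rho> x * (- h x - ln Z) \<partial>lborel) = - m - ln Z"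
    using \<rho>h_int \<rho>_int by (simp add: right_diff_distrib m_def \<rho>_one)
  \<comment> \<open>The divergence is \<open>- m - ln Z\<close> with \<open>m \<ge> 0\<close>, so
    bounding \<open>- ln Z\<close> by \<open>2 * q\<close> suffices.\<close>
  have "- ln Z = ln (1 / Z)" using Z_pos by (simp add: ln_div)
  also have "\<dots> \<le> 1 / Z - 1" using Z_pos by (intro ln_le_minus_one) simp
  also have "\<dots> \<le> 2 * q"
  proof -
    \<comment> \<open>The right side exceeds 1 by \<open>q * (1 - 2 * q)\<close>.\<close>
    have "1 \<le> (1 + 2 * q) * (1 - q)"
      using mult_nonneg_nonneg[of q "1 - 2 * q"] q q_nonneg by (simp add: algebra_simps)
    also have "\<dots> \<le> (1 + 2 * q) * Z"
      using Z_ge q_nonneg by (intro mult_left_mono) auto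
    finally show ?thesis using Z_pos by (simp add: field_simps)
  qed
  finally have "- m - ln Z \<le> \<epsilon>" using q m_nonneg by linarith
  then have \<rho>_near: "\<rho> \<in> KL_neighborhood \<rho>s \<epsilon>"
    using \<rho>_dens by (simp add: KL_neighborhood_def KL_def ln_eq ln_int ln_mean)

  \<comment> \<open>A centred potential supported where the bump is high\<close>
  define \<phi> where "\<phi> = (\<lambda>x. flat 0 (h x - 3))"
  have \<phi>_smooth: "smooth_fun \<phi>"
    unfolding \<phi>_def by (intro smooth_fun_compose[OF smooth_fun_flat] smooth_fun_diff smooth_fun_const h_smooth)
  note \<phi>_cont = smooth_fun_imp_continuous[OF \<phi>_smooth]
  have \<phi>_nonneg: "0 \<le> \<phi> x" and \<phi>_le: "\<phi> x \<le> 1" for x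
    by (simp_all add: \<phi>_def flat_nonneg flat_0_le_1)
  have \<phi>_0: "0 < \<phi> 0"
    by (simp add: \<phi>_def flat_0_pos_iff h_0)
  have \<phi>_int: "integrable lborel (\<lambda>x. \<rho> x * \<phi> x)"
    by (rule integrable_mult_bounded[OF \<rho>_int \<phi>_cont, of 1]) (simp add: \<phi>_nonneg \<phi>_le)
  have \<phi>2_int: "integrable lborel (\<lambda>x. \<rho> x * (\<phi> x)\<^sup>2)"
    by (rule integrable_mult_bounded[OF \<rho>_int, of _ 1])
      (auto intro: continuous_on_power \<phi>_cont power_le_one simp: \<phi>_nonneg \<phi>_le)
  \<comment> \<open>This \<open>a\<close> gives \<open>\<phi> * (\<phi> - a)\<close> mean zero under
    \<open>\<rho>\<close>. Centring by a factor rather than by subtracting a constant from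
    \<open>\<phi>\<close> keeps the potential zero wherever \<open>\<phi>\<close> is.\<close>
  define a where "a = (\<integral>x. \<rho> x * (\<phi> x)\<^sup>2 \<partial>lborel) / (\<integral>x. \<rho> x * \<phi> x \<partial>lborel)"
  have "0 < (\<integral>x. \<rho> x * \<phi> x \<partial>lborel)"
    by (rule integral_pos_of_continuous[OF _ \<phi>_int, of 0])
      (auto intro: continuous_on_mult \<rho>_cont \<phi>_cont simp: \<phi>_nonneg \<rho>_pos \<phi>_0 less_imp_le)
  then have a: "a * (\<integral>x. \<rho> x * \<phi> x \<partial>lborel) = (\<integral>x. \<rho> x * (\<phi> x)\<^sup>2 \<partial>lborel)"
    by (simp add: a_def)
  define \<psi> where "\<psi> = (\<lambda>x. \<phi> x * (\<phi> x - a))"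
  have \<psi>_smooth: "smooth_fun \<psi>"
    unfolding \<psi>_def by (intro smooth_fun_mult smooth_fun_diff smooth_fun_const \<phi>_smooth)
  note \<psi>_cont = smooth_fun_imp_continuous[OF \<psi>_smooth]
  have \<psi>_split: "\<rho> x * \<psi> x = \<rho> x * (\<phi> x)\<^sup>2 - a * (\<rho> x * \<phi> x)" for x
    by (simp add: \<psi>_def power2_eq_square algebra_simps)
  have \<psi>_int: "integrable lborel (\<lambda>x. \<rho> x * \<psi> x)"
    unfolding \<psi>_split using \<phi>_int \<phi>2_int by simp
  have \<psi>_mean: "expect \<rho> \<psi> = 0"
    unfolding expect_def \<psi>_split using \<phi>_int \<phi>2_int a by simp
  have \<psi>_bound: "\<bar>\<psi> x\<bar> \<le> 1 + \<bar>a\<bar>" for x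
  proof -
    have "\<bar>\<psi> x\<bar> \<le> 1 * \<bar>\<phi> x - a\<bar>"
      unfolding \<psi>_def abs_mult using \<phi>_nonneg[of x] \<phi>_le[of x] by (intro mult_right_mono) auto
    also have "\<dots> \<le> 1 + \<bar>a\<bar>"
      using \<phi>_nonneg[of x] \<phi>_le[of x] by (simp add: abs_if)
    finally show ?thesis .
  qed
  have \<psi>2_bound: "(\<psi> x)\<^sup>2 \<le> (1 + \<bar>a\<bar>)\<^sup>2" for x
    using power_mono[OF \<psi>_bound abs_ge_zero, of x 2] by simp
  have var_int: "integrable lborel (\<lambda>x. \<rho> x * (\<psi> x)\<^sup>2)"
    by (rule integrable_mult_bounded[OF \<rho>_int, of _ "(1 + \<bar>a\<bar>)\<^sup>2"])
      (auto intro: continuous_on_power \<psi>_cont \<psi>2_bound)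
  have third_int: "integrable lborel (\<lambda>x. \<rho> x * (\<psi> x)\<^sup>2 * (m - h x))"
  proof (rule integrable_mult_bounded[OF var_int])
    show "continuous_on UNIV (\<lambda>x. m - h x)"
      by (intro continuous_on_diff continuous_on_const h_cont)
    show "\<bar>m - h x\<bar> \<le> 4 + m" for x
      using h_nonneg[of x] h_le[of x] m_nonneg by (simp add: abs_if)
  qed
  \<comment> \<open>The constant \<open>ln Z\<close> cancels on centring.\<close>
  have log_centred: "ln (\<rho> x / \<rho>s x) - expect \<rho> (\<lambda>y. ln (\<rho> y / \<rho>s y)) = m - h x" for x
    by (simp add: ln_eq expect_def ln_mean)
  have converges: "FR_Hess_KL_converges \<rho>s \<rho> \<psi>"
    unfolding FR_Hess_KL_converges_def log_centred \<psi>_mean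
    using ln_int var_int third_int by (simp add: ln_eq)

  \<comment> \<open>Negativity of the Hessian form\<close>
  have "0 < (\<integral>x. - (\<rho> x * (\<psi> x)\<^sup>2) - 1/2 * (\<rho> x * (\<psi> x)\<^sup>2 * (m - h x)) \<partial>lborel)"
  proof -
    \<comment> \<open>The integrand of minus the Hessian form; where \<open>\<psi>\<close> is
      nonzero, its sign is that of \<open>h x - m - 2\<close>.\<close>
    have eq: "- (\<rho> x * (\<psi> x)\<^sup>2) - 1/2 * (\<rho> x * (\<psi> x)\<^sup>2 * (m - h x)) = \<rho> x * (\<psi> x)\<^sup>2 * ((h x - m - 2) / 2)" for x
      by (simp add: field_simps)
    \<comment> \<open>The cut-off level 3 was chosen for this: \<open>\<phi> x \<noteq> 0\<close>
      forces \<open>h x > 3\<close>, while \<open>m + 2 \<le> 3\<close>.\<close>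
    have gap: "0 < h x - m - 2" if "\<phi> x \<noteq> 0" for x
    proof -
      have "0 < \<phi> x" using that \<phi>_nonneg[of x] by linarith
      then show ?thesis using m_le by (simp add: \<phi>_def flat_0_pos_iff)
    qed
    have nonneg: "0 \<le> \<rho> x * (\<psi> x)\<^sup>2 * ((h x - m - 2) / 2)" for x
      using gap[of x] \<rho>_pos[of x] by (cases "\<phi> x = 0") (auto simp: \<psi>_def)
    \<comment> \<open>Strict positivity needs a point where \<open>\<psi>\<close> is nonzero, that
      is, where \<open>\<phi>\<close> is neither 0 nor \<open>a\<close>. Since \<open>\<phi>\<close>
      vanishes at a unit vector, connectedness yields the value \<open>\<phi> 0 / 2\<close>; it and
      \<open>\<phi> 0\<close> are distinct and positive, so one of them differs from
      \<open>a\<close>.\<close>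
    obtain b :: 'a where b: "b \<in> Basis" using nonempty_Basis by blast
    have "\<phi> b = 0"
      using n b by (simp add: \<phi>_def h_def bump_def flat_def)
    moreover have "connected (range \<phi>)"
      using \<phi>_cont connected_UNIV by (rule connected_continuous_image)
    ultimately have "\<phi> 0 / 2 \<in> range \<phi>"
      using connectedD_interval[of "range \<phi>" "\<phi> b" "\<phi> 0" "\<phi> 0 / 2"] \<phi>_0 by simp
    then obtain y where "\<phi> y = \<phi> 0 / 2" by force
    then obtain z where z: "\<phi> z \<noteq> 0" "\<phi> z \<noteq> a"
      using \<phi>_0 that[of y] that[of 0] by (cases "\<phi> 0 = a") auto
    show ?thesis
      unfolding eq
    proof (rule integral_pos_of_continuous[where a = z])
      show "continuous_on UNIV (\<lambda>x. \<rho> x * (\<psi> x)\<^sup>2 * ((h x - m - 2) / 2))"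
        by (intro continuous_intros \<rho>_cont \<psi>_cont h_cont) auto
      show "integrable lborel (\<lambda>x. \<rho> x * (\<psi> x)\<^sup>2 * ((h x - m - 2) / 2))"
        unfolding eq[symmetric] using var_int third_int by simp
      show "0 \<le> \<rho> x * (\<psi> x)\<^sup>2 * ((h x - m - 2) / 2)" for x
        by (rule nonneg)
      show "0 < \<rho> z * (\<psi> z)\<^sup>2 * ((h z - m - 2) / 2)"
        using gap[OF z(1)] \<rho>_pos[of z] z by (simp add: \<psi>_def)
    qed
  qed
  then have "FR_Hess_KL \<rho>s \<rho> \<psi> < 0"
    unfolding FR_Hess_KL_def log_centred \<psi>_mean using var_int third_int by simp
  moreover have "FR_tangent \<rho> \<psi> (\<lambda>x. \<rho> x * (\<psi> x - expect \<rho> \<psi>))"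
    by (simp add: FR_tangent_def \<psi>_smooth \<psi>_int)
  ultimately show ?thesis
    using \<rho>_near converges by blast
qed

theorem theorem3p3:
  fixes \<rho>s :: "real ^ 'd \<Rightarrow> real"
  assumes "\<rho>s \<in> smooth_densities"
  shows "\<not> FR_KL_geodesically_convex_on smooth_densities \<rho>s \<and>
    (\<forall>\<epsilon>>0. \<not> FR_KL_geodesically_convex_on (KL_neighborhood \<rho>s \<epsilon>) \<rho>s \<and>
       (\<exists>\<rho>\<in>KL_neighborhood \<rho>s \<epsilon>. \<exists>\<sigma> \<psi>. FR_tangent \<rho> \<psi> \<sigma> \<and> FR_Hess_KL_converges \<rho>s \<rho> \<psi> \<and>
          FR_Hess_KL \<rho>s \<rho> \<psi> < 0))"
proof -
  note negative = exists_negative_FR_Hess_KL[OF assms]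
  have "\<not> FR_KL_geodesically_convex_on (KL_neighborhood \<rho>s \<epsilon>) \<rho>s" if "0 < \<epsilon>" for \<epsilon>
    using negative[OF that] unfolding FR_KL_geodesically_convex_on_def by (meson not_le)
  \<comment> \<open>The neighbourhood for \<open>\<epsilon> = 1\<close> lies in
    \<open>smooth_densities\<close>, so its witness refutes convexity there too.\<close>
  moreover have "\<not> FR_KL_geodesically_convex_on smooth_densities \<rho>s"
    using negative[of 1] unfolding FR_KL_geodesically_convex_on_def KL_neighborhood_def
    by (metis (no_types, lifting) mem_Collect_eq not_le zero_less_one)
  ultimately show ?thesis using negative by blast
qed

end
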